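(* Let $1<p<\infty$ and $0<\gamma<1$, let $\{f_i\}\subset L^p(X)$ be a sequence and let $f\in L^p(X)$. (i) If $f_i\to f$ weakly in $L^p(X)$, then $$\liminf_{i\to\infty}I_\gamma f_i\le I_\gamma f\le\limsup_{i\to\infty}I_\gamma f_i\qquad \mathcal{C}_{\gamma,p}\text{-q.e.}$$ (ii) If $f_i\to f$ weakly in $L^p_+(X)$ (i.e. $f_i, f\in L^p_+(X)$ and $f_i\to f$ weakly in $L^p(X)$), then $$I_\gamma f\le\liminf_{i\to\infty}I_\gamma f_i\quad\text{everywhere on } X,$$ and $$I_\gamma f=\liminf_{i\to\infty}I_\gamma f_i\qquad \mathcal{C}_{\gamma,p}\text{-q.e.}$$
   Context: Setting: $X=(X,d,\mu)$ is a locally compact metric space equipped with a Borel regular outer measure $\mu$ that is doubling, i.e. there is a constant $c_d\ge 1$ with $\mu(B(x,2r))\le c_d\,\mu(B(x,r))$ for every ball $B(x,r)=\{y\in X: d(y,x)<r\}$. Every open ball has positive and finite measure. Spheres have measure zero, $\mu(\{y\in X: d(x,y)=r\})=0$ for all $x\in X$, $r>0$, and points have measure zero, $\mu(\{x\})=0$ for all $x\in X$. For $0<\gamma<1$, the Riesz potential of order $\gamma$ of a measurable function $f$ is $$I_\gamma f(x)=\int_X \frac{f(y)}{\mu(B(x,d(x,y)))^{1-\gamma}}\,d\mu(y)$$ (the single point $y=x$ may be omitted from the domain of integration, since it is $\mu$-null). For a signed $f\in L^p(X)$, $I_\gamma f(x)$ is considered at those points $x$ where the integral is well-defined; the remaining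 points form a set of capacity zero. $L^p_+(X)$ denotes the set of non-negative functions in $L^p(X)=L^p(X,\mu)$. For $1<p<\infty$ and any $E\subset X$, the Riesz $(\gamma,p)$-capacity is $\mathcal{C}_{\gamma,p}(E)=\inf_{f\in\mathcal{A}(E)}\|f\|_{L^p(X)}^p$, where $\mathcal{A}(E)=\{f\in L^p_+(X): I_\gamma f\ge 1\text{ on }E\}$ and $\mathcal{C}_{\gamma,p}(E)=\infty$ if $\mathcal{A}(E)=\emptyset$. A property holds $\mathcal{C}_{\gamma,p}$-q.e. if it holds for all $x\in X$ except those in a set $E$ with $\mathcal{C}_{\gamma,p}(E)=0$. *)

theory Defs
  imports "HOL-Analysis.Analysis"
begin

definition borel_regular_outer_measure :: "('a::topological_space set \<Rightarrow> ennreal) \<Rightarrow> bool" where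
  "borel_regular_outer_measure \<mu> \<longleftrightarrow>
     outer_measure_space UNIV \<mu> \<and>
     sets borel \<subseteq> lambda_system UNIV UNIV \<mu> \<and>
     (\<forall>A. \<exists>B\<in>sets borel. A \<subseteq> B \<and> \<mu> B = \<mu> A)"

definition doubling :: "('a::metric_space set \<Rightarrow> ennreal) \<Rightarrow> bool" where
  "doubling \<mu> \<longleftrightarrow>
     (\<exists>c::real. c \<ge> 1 \<and> (\<forall>x r. r > 0 \<longrightarrow> \<mu> (ball x (2 * r)) \<le> ennreal c * \<mu> (ball x r)))"

text \<open>The complete measure obtained by restricting the outer measure to its
  Caratheodory-measurable sets; measurability and integrals refer to it.\<close>

definition cara :: "('a set \<Rightarrow> ennreal) \<Rightarrow> 'a measure" where
  "cara \<mu> = measure_of UNIV (lambda_system UNIV UNIV \<mu>) \<mu>"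

text \<open>Elements of \<open>L\<^sup>p\<close> are represented by real-valued functions, without
  passing to the quotient by almost everywhere equality. Accordingly, non-negativity in
  \<open>L\<^sup>p\<^sub>+\<close> is required almost everywhere.\<close>

definition Lp :: "real \<Rightarrow> 'a measure \<Rightarrow> ('a \<Rightarrow> real) set" where
  "Lp p M = {f \<in> borel_measurable M. integrable M (\<lambda>x. \<bar>f x\<bar> powr p)}"

definition Lp_norm :: "real \<Rightarrow> 'a measure \<Rightarrow> ('a \<Rightarrow> real) \<Rightarrow> real" where
  "Lp_norm p M f = (\<integral>x. \<bar>f x\<bar> powr p \<partial>M) powr (1 / p)"

definition Lp_plus :: "real \<Rightarrow> 'a measure \<Rightarrow> ('a \<Rightarrow> real) set" where
  "Lp_plus p M = {f \<in> Lp p M. AE x in M. 0 \<le> f x}"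

text \<open>A bounded functional takes equal values on functions that agree almost everywhere,
  so these are exactly the elements of the dual of the quotient space.\<close>

definition Lp_dual :: "real \<Rightarrow> 'a measure \<Rightarrow> (('a \<Rightarrow> real) \<Rightarrow> real) set" where
  "Lp_dual p M = {\<Phi>.
     (\<forall>f\<in>Lp p M. \<forall>g\<in>Lp p M. \<Phi> (\<lambda>x. f x + g x) = \<Phi> f + \<Phi> g) \<and>
     (\<forall>f\<in>Lp p M. \<forall>c::real. \<Phi> (\<lambda>x. c * f x) = c * \<Phi> f) \<and>
     (\<exists>C. \<forall>f\<in>Lp p M. \<bar>\<Phi> f\<bar> \<le> C * Lp_norm p M f)}"

definition weakly_converges_Lp ::
  "real \<Rightarrow> 'a measure \<Rightarrow> (nat \<Rightarrow> 'a \<Rightarrow> real) \<Rightarrow> ('a \<Rightarrow> real) \<Rightarrow> bool" where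
  "weakly_converges_Lp p M F f \<longleftrightarrow> (\<forall>\<Phi>\<in>Lp_dual p M. (\<lambda>i. \<Phi> (F i)) \<longlonglongrightarrow> \<Phi> f)"

text \<open>Since \<open>ennreal\<close> maps negative reals to \<open>0\<close>, this is the potential of the positive part
  of \<open>f\<close>. At \<open>y = x\<close> the ball is empty and the quotient is \<open>0\<close>, so that the (null) point \<open>x\<close>
  is omitted from the domain of integration.\<close>

definition riesz_pos ::
  "('a::metric_space set \<Rightarrow> ennreal) \<Rightarrow> real \<Rightarrow> ('a \<Rightarrow> real) \<Rightarrow> 'a \<Rightarrow> ennreal" where
  "riesz_pos \<mu> \<gamma> f x =
     (\<integral>\<^sup>+ y. ennreal (f y / enn2real (\<mu> (ball x (dist x y))) powr (1 - \<gamma>)) \<partial>cara \<mu>)"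

text \<open>The integral is well-defined in \<open>[-\<infinity>, \<infinity>]\<close> unless both the positive
  and the negative part have infinite integral.\<close>

definition riesz_defined ::
  "('a::metric_space set \<Rightarrow> ennreal) \<Rightarrow> real \<Rightarrow> ('a \<Rightarrow> real) \<Rightarrow> 'a \<Rightarrow> bool" where
  "riesz_defined \<mu> \<gamma> f x \<longleftrightarrow>
     riesz_pos \<mu> \<gamma> f x < \<infinity> \<or> riesz_pos \<mu> \<gamma> (\<lambda>y. - f y) x < \<infinity>"

definition riesz_potential ::
  "('a::metric_space set \<Rightarrow> ennreal) \<Rightarrow> real \<Rightarrow> ('a \<Rightarrow> real) \<Rightarrow> 'a \<Rightarrow> ereal" where
  "riesz_potential \<mu> \<gamma> f x =
     enn2ereal (riesz_pos \<mu> \<gamma> f x) - enn2ereal (riesz_pos \<mu> \<gamma> (\<lambda>y. - f y) x)"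

definition riesz_admissible ::
  "('a::metric_space set \<Rightarrow> ennreal) \<Rightarrow> real \<Rightarrow> real \<Rightarrow> 'a set \<Rightarrow> ('a \<Rightarrow> real) set" where
  "riesz_admissible \<mu> \<gamma> p E =
     {f \<in> Lp_plus p (cara \<mu>). \<forall>x\<in>E. 1 \<le> riesz_potential \<mu> \<gamma> f x}"

text \<open>The infimum of the empty set in \<open>ennreal\<close> is \<open>\<infinity>\<close>.\<close>

definition riesz_capacity ::
  "('a::metric_space set \<Rightarrow> ennreal) \<Rightarrow> real \<Rightarrow> real \<Rightarrow> 'a set \<Rightarrow> ennreal" where
  "riesz_capacity \<mu> \<gamma> p E =
     (INF f\<in>riesz_admissible \<mu> \<gamma> p E. ennreal (Lp_norm p (cara \<mu>) f powr p))"

definition quasi_everywhere ::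
  "('a::metric_space set \<Rightarrow> ennreal) \<Rightarrow> real \<Rightarrow> real \<Rightarrow> ('a \<Rightarrow> bool) \<Rightarrow> bool" where
  "quasi_everywhere \<mu> \<gamma> p P \<longleftrightarrow>
     (\<exists>E. riesz_capacity \<mu> \<gamma> p E = 0 \<and> (\<forall>x. x \<notin> E \<longrightarrow> P x))"

end

theory Submission
  imports Defs "HOL-Library.Function_Algebras"
begin

text \<open>
  Write \<open>K x y\<close> for the Riesz kernel, so that the potential of \<open>f\<close> at \<open>x\<close> is the integral of
  \<open>f y * K x y\<close> in \<open>y\<close>.

  The quasi-everywhere statements come from Mazur's lemma (\<open>mazur_Lp\<close>): weak convergence provides
  convex combinations \<open>g n\<close> of the tails \<open>F n, F (n + 1), \<dots>\<close> with \<open>\<parallel>g n - f\<parallel> < (1 / 2) ^ n\<close>. By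
  linearity the potential of \<open>g n\<close> at \<open>x\<close> is the same convex combination of the potentials of the
  \<open>F i\<close>, hence lies between the infimum and the supremum of their \<open>n\<close>-th tail. So both inequalities
  hold at each \<open>x\<close> where all these potentials are finite and those of \<open>g n\<close> converge to that of \<open>f\<close>.

  To see that this happens outside a set of capacity zero, one sums the functions \<open>\<bar>g n - f\<bar>\<close> and
  suitable multiples of the \<open>\<bar>F i\<bar>\<close> to a single \<open>h\<close> in \<open>L\<^sup>p\<close>. The set where the potential of \<open>h\<close> is
  infinite has capacity zero, because all positive multiples of \<open>h\<close> are admissible for it
  (\<open>riesz_capacity_zero_if_potential_infinite\<close>). Elsewhere the potentials of \<open>\<bar>g n - f\<bar>\<close> are
  summable and thus tend to \<open>0\<close> (\<open>riesz_series_quasi_everywhere\<close>).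

  The inequality that holds everywhere for non-negative functions is tested directly: integration
  against a truncation of \<open>K x\<close> is a bounded functional, and the truncations increase
  to \<open>K x\<close> (\<open>riesz_pos_le_liminf\<close>).

  Mazur's lemma itself rests on a separation theorem (\<open>separate_point_convex_subspace\<close>), obtained
  from the Hahn-Banach theorem in the form that every sublinear functional dominates a linear one.
  Zorn's lemma yields a minimal sublinear functional, and minimality forces linearity
  (\<open>minimal_sublinear_linear\<close>).
\<close>

section \<open>Sublinear functionals and the Hahn-Banach theorem\<close>

definition sublinear :: "('v::real_vector \<Rightarrow> real) \<Rightarrow> bool" where
  "sublinear s \<longleftrightarrow>
     (\<forall>x y. s (x + y) \<le> s x + s y) \<and> (\<forall>c x. 0 \<le> c \<longrightarrow> s (c *\<^sub>R x) = c * s x)"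

lemma sublinear_add: "sublinear s \<Longrightarrow> s (x + y) \<le> s x + s y"
  by (simp add: sublinear_def)

lemma sublinear_scaleR: "sublinear s \<Longrightarrow> 0 \<le> c \<Longrightarrow> s (c *\<^sub>R x) = c * s x"
  by (simp add: sublinear_def)

lemma sublinear_zero: "sublinear s \<Longrightarrow> s 0 = 0"
  using sublinear_scaleR[of s 0 0] by simp

lemma sublinear_uminus: "sublinear s \<Longrightarrow> - s (- x) \<le> s x"
  using sublinear_add[of s x "- x"] sublinear_zero[of s] by simp

text \<open>The inequality for the factor \<open>1 / c\<close> is the reverse inequality for \<open>c\<close>, and homogeneity for
  \<open>c = 2\<close> forces the value \<open>0\<close> at \<open>0\<close>.\<close>

lemma sublinearI:
  assumes add: "\<And>x y. s (x + y) \<le> s x + s y"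
    and scale: "\<And>c x. 0 < c \<Longrightarrow> s (c *\<^sub>R x) \<le> c * s x"
  shows "sublinear s"
proof -
  have eq: "s (c *\<^sub>R x) = c * s x" if "0 < c" for c x
  proof (rule antisym)
    show "s (c *\<^sub>R x) \<le> c * s x"
      by (rule scale[OF that])
    have "s ((1 / c) *\<^sub>R c *\<^sub>R x) \<le> (1 / c) * s (c *\<^sub>R x)"
      using that by (intro scale) simp
    then show "c * s x \<le> s (c *\<^sub>R x)"
      using that by (simp add: field_simps)
  qed
  have "s 0 = 0"
    using eq[of 2 0] by simp
  with eq have "s (c *\<^sub>R x) = c * s x" if "0 \<le> c" for c x
    using that by (cases "c = 0") auto
  then show ?thesis
    by (simp add: sublinear_def add)
qed

text \<open>The three infima that occur below (over a chain of functionals, over shifts along a ray, over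
  a cone spanned by a convex set) are sublinear for the same reason: the index set absorbs sums
  and positive multiples.\<close>

lemma sublinear_INF:
  assumes ne: "I \<noteq> {}"
    and bdd: "\<And>x. bdd_below ((\<lambda>i. \<sigma> i x) ` I)"
    and add: "\<And>i j x y. i \<in> I \<Longrightarrow> j \<in> I \<Longrightarrow> \<exists>k\<in>I. \<sigma> k (x + y) \<le> \<sigma> i x + \<sigma> j y"
    and scale: "\<And>i c x. i \<in> I \<Longrightarrow> 0 < c \<Longrightarrow> \<exists>k\<in>I. \<sigma> k (c *\<^sub>R x) \<le> c * \<sigma> i x"
  shows "sublinear (\<lambda>x. INF i\<in>I. \<sigma> i x)"
proof (rule sublinearI)
  let ?s = "\<lambda>x. INF i\<in>I. \<sigma> i x"
  fix x y
  have "?s (x + y) - \<sigma> i x \<le> \<sigma> j y" if "i \<in> I" "j \<in> I" for i j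
    using add[OF that, of x y] cINF_lower2[OF bdd] by (metis diff_le_eq add.commute)
  then have "?s (x + y) - \<sigma> i x \<le> ?s y" if "i \<in> I" for i
    using ne that by (intro cINF_greatest) auto
  then have "?s (x + y) - ?s y \<le> \<sigma> i x" if "i \<in> I" for i
    using that by (simp add: algebra_simps)
  then have "?s (x + y) - ?s y \<le> ?s x"
    using ne by (intro cINF_greatest) auto
  then show "?s (x + y) \<le> ?s x + ?s y"
    by simp
next
  let ?s = "\<lambda>x. INF i\<in>I. \<sigma> i x"
  fix c :: real and x assume c: "0 < c"
  have "?s (c *\<^sub>R x) / c \<le> \<sigma> i x" if "i \<in> I" for i
    using scale[OF that c, of x] cINF_lower2[OF bdd] c by (simp add: divide_le_eq mult.commute) metis
  then have "?s (c *\<^sub>R x) / c \<le> ?s x"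
    using ne by (intro cINF_greatest) auto
  then show "?s (c *\<^sub>R x) \<le> c * ?s x"
    using c by (simp add: field_simps)
qed

text \<open>The largest sublinear functional below \<open>s\<close> whose value at \<open>- y\<close> is at most \<open>- s y\<close>. A minimal
  \<open>s\<close> must agree with it, which makes \<open>s\<close> additive.\<close>

lemma sublinear_shift:
  assumes s: "sublinear s"
  shows "sublinear (\<lambda>x. INF t\<in>{0..}. s (x + t *\<^sub>R y) - t * s y)"
    and "bdd_below ((\<lambda>t. s (x + t *\<^sub>R y) - t * s y) ` {0..})"
proof -
  have bdd: "bdd_below ((\<lambda>t. s (x + t *\<^sub>R y) - t * s y) ` {0..})" for x
  proof (rule bdd_belowI2)
    fix t :: real assume "t \<in> {0..}"
    then have "t * s y = s (t *\<^sub>R y)"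
      by (simp add: sublinear_scaleR[OF s])
    also have "\<dots> \<le> s (x + t *\<^sub>R y) + s (- x)"
      using sublinear_add[OF s, of "x + t *\<^sub>R y" "- x"] by simp
    finally show "- s (- x) \<le> s (x + t *\<^sub>R y) - t * s y"
      by simp
  qed
  then show "bdd_below ((\<lambda>t. s (x + t *\<^sub>R y) - t * s y) ` {0..})" .
  show "sublinear (\<lambda>x. INF t\<in>{0..}. s (x + t *\<^sub>R y) - t * s y)"
  proof (rule sublinear_INF[OF _ bdd])
    fix t u :: real and x z assume "t \<in> {0..}" "u \<in> {0..}"
    then show "\<exists>k\<in>{0..}. s (x + z + k *\<^sub>R y) - k * s y
        \<le> (s (x + t *\<^sub>R y) - t * s y) + (s (z + u *\<^sub>R y) - u * s y)"
      using sublinear_add[OF s, of "x + t *\<^sub>R y" "z + u *\<^sub>R y"]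
      by (intro bexI[of _ "t + u"]) (auto simp: algebra_simps)
  next
    fix t c :: real and x assume "t \<in> {0..}" "0 < c"
    then show "\<exists>k\<in>{0..}. s (c *\<^sub>R x + k *\<^sub>R y) - k * s y \<le> c * (s (x + t *\<^sub>R y) - t * s y)"
      using sublinear_scaleR[OF s, of c "x + t *\<^sub>R y"]
      by (intro bexI[of _ "c * t"]) (auto simp: algebra_simps)
  qed simp
qed

lemma minimal_sublinear_linear:
  assumes s: "sublinear s"
    and min: "\<And>s'. sublinear s' \<Longrightarrow> s' \<le> s \<Longrightarrow> s' = s"
  shows "linear s"
proof -
  have super: "s x + s y \<le> s (x + y)" for x y
  proof -
    let ?s' = "\<lambda>x. INF t\<in>{0..}. s (x + t *\<^sub>R y) - t * s y"
    have "?s' \<le> s"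
      by (rule le_funI, rule cINF_lower2[OF sublinear_shift(2)[OF s], of 0]) auto
    then have "?s' = s"
      by (intro min sublinear_shift(1) s)
    then have "?s' x = s x"
      by (rule fun_cong)
    moreover have "?s' x \<le> s (x + y) - s y"
      by (rule cINF_lower2[OF sublinear_shift(2)[OF s], of 1]) auto
    ultimately show ?thesis
      by linarith
  qed
  have add: "s (x + y) = s x + s y" for x y
    using super[of x y] sublinear_add[OF s, of x y] by simp
  have neg: "s (- x) = - s x" for x
    using add[of x "- x"] sublinear_zero[OF s] by simp
  show ?thesis
  proof (rule linearI)
    show "s (x + y) = s x + s y" for x y
      by (rule add)
    show "s (c *\<^sub>R x) = c *\<^sub>R s x" for c x
      using sublinear_scaleR[OF s, of c x] sublinear_scaleR[OF s, of "- c" x] neg[of "c *\<^sub>R x"]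
      by (cases "0 \<le> c") auto
  qed
qed

text \<open>Zorn's lemma gives a minimal sublinear functional below \<open>q\<close>, and minimal ones are linear. The
  infimum of a chain stays finite because \<open>s x \<ge> - s (- x) \<ge> - q (- x)\<close> for every \<open>s \<le> q\<close>.\<close>

lemma hahn_banach_sublinear:
  assumes q: "sublinear q"
  obtains \<Phi> where "linear \<Phi>" and "\<And>x. \<Phi> x \<le> q x"
proof -
  let ?A = "{s. sublinear s \<and> s \<le> q}"
  have "\<exists>m\<in>?A. \<forall>a\<in>?A. a \<le> m \<longrightarrow> a = m"
  proof (rule predicate_Zorn[where P = "\<lambda>a b. b \<le> a"])
    show "partial_order_on ?A (relation_of (\<lambda>a b. b \<le> a) ?A)"
      by (rule partial_order_on_relation_ofI) auto
    fix C assume C: "C \<in> Chains (relation_of (\<lambda>a b. b \<le> a) ?A)"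
    then have sub: "\<And>s. s \<in> C \<Longrightarrow> sublinear s \<and> s \<le> q"
      and total: "\<And>s t. s \<in> C \<Longrightarrow> t \<in> C \<Longrightarrow> s \<le> t \<or> t \<le> s"
      by (auto simp: Chains_def relation_of_def)
    show "\<exists>u\<in>?A. \<forall>a\<in>C. u \<le> a"
    proof (cases "C = {}")
      case True
      with q show ?thesis by auto
    next
      case False
      have bdd: "bdd_below ((\<lambda>s. s x) ` C)" for x
      proof (rule bdd_belowI2)
        fix s assume "s \<in> C"
        then have "s (- x) \<le> q (- x)" "- s (- x) \<le> s x"
          using sub[of s] sublinear_uminus[of s x] by (auto simp: le_fun_def)
        then show "- q (- x) \<le> s x"
          by simp
      qed
      let ?u = "\<lambda>x. INF s\<in>C. s x"
      have lower: "?u \<le> s" if "s \<in> C" for s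
        by (rule le_funI) (rule cINF_lower[OF bdd that])
      have "sublinear ?u"
      proof (rule sublinear_INF[OF False bdd])
        fix s t x y assume st: "s \<in> C" "t \<in> C"
        show "\<exists>k\<in>C. k (x + y) \<le> s x + t y"
        proof (cases "s \<le> t")
          case True
          then have "s (x + y) \<le> s x + t y"
            using sub[OF st(1)] sublinear_add[of s x y] le_funD[OF True, of y] by linarith
          with st show ?thesis by blast
        next
          case False
          then have "t \<le> s"
            using total[OF st] by blast
          then have "t (x + y) \<le> s x + t y"
            using sub[OF st(2)] sublinear_add[of t x y] le_funD[of t s x] by linarith
          with st show ?thesis by blast
        qed
      next
        fix s x and c :: real assume "s \<in> C" "0 < c"
        then show "\<exists>k\<in>C. k (c *\<^sub>R x) \<le> c * s x"
          using sub[of s] sublinear_scaleR[of s c x] by (intro bexI[of _ s]) auto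
      qed
      moreover have "?u \<le> q"
        using False lower sub by (meson ex_in_conv order_trans)
      ultimately show ?thesis
        using lower by blast
    qed
  qed
  then obtain m where m: "sublinear m" "m \<le> q"
    and min: "\<And>s. sublinear s \<Longrightarrow> s \<le> q \<Longrightarrow> s \<le> m \<Longrightarrow> s = m"
    by blast
  have "linear m"
    using m min by (intro minimal_sublinear_linear) (auto intro: order_trans)
  with m that show ?thesis
    by (auto simp: le_fun_def)
qed

lemma convex_cone_sum:
  assumes K: "convex K" and "k \<in> K" "l \<in> K" "0 \<le> (t::real)" "0 \<le> u"
  obtains w where "w \<in> K" "t *\<^sub>R k + u *\<^sub>R l = (t + u) *\<^sub>R w"
proof (cases "t + u = 0")
  case True
  with assms have "t = 0" "u = 0" by auto
  with assms that show ?thesis by auto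
next
  case False
  let ?w = "(t / (t + u)) *\<^sub>R k + (u / (t + u)) *\<^sub>R l"
  have "?w \<in> K"
    using assms False by (intro convexD[OF K]) (auto simp: add_divide_distrib[symmetric])
  moreover have "(t + u) *\<^sub>R ?w = t *\<^sub>R k + u *\<^sub>R l"
    using False by (simp add: scaleR_add_right)
  ultimately show ?thesis
    using that by metis
qed

text \<open>The functional \<open>q\<close> of the proof compares \<open>x\<close> with the cone over \<open>K - z\<close> and grants a bonus of \<open>d\<close>
  per unit of the cone. It stays above \<open>- N x\<close> because \<open>N\<close> is at least \<open>d\<close> on \<open>K - z\<close>. Any linear
  \<open>\<Phi> \<le> q\<close> is bounded by \<open>N\<close> (apex of the cone) and satisfies \<open>\<Phi> (z - k) \<le> - d\<close> (unit
  step towards \<open>k\<close>).\<close>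

lemma separate_point_convex:
  fixes N :: "'v::real_vector \<Rightarrow> real"
  assumes N: "sublinear N" and sym: "\<And>x. N (- x) = N x"
    and K: "convex K" "K \<noteq> {}" and far: "\<And>k. k \<in> K \<Longrightarrow> d \<le> N (k - z)"
  obtains \<Phi> where "linear \<Phi>" "\<And>x. \<bar>\<Phi> x\<bar> \<le> N x" "\<And>k. k \<in> K \<Longrightarrow> \<Phi> z + d \<le> \<Phi> k"
proof -
  define I where "I = {0::real..} \<times> K"
  define \<sigma> where "\<sigma> = (\<lambda>(t, k) x. N (x + t *\<^sub>R (k - z)) - t * d)"
  define q where "q = (\<lambda>x. INF i\<in>I. \<sigma> i x)"
  have bdd: "bdd_below ((\<lambda>i. \<sigma> i x) ` I)" for x
  proof (rule bdd_belowI2)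
    fix i assume "i \<in> I"
    then obtain t k where i: "i = (t, k)" "0 \<le> t" "k \<in> K"
      by (auto simp: I_def)
    have "t * d \<le> t * N (k - z)"
      using far i by (intro mult_left_mono) auto
    also have "\<dots> = N (t *\<^sub>R (k - z))"
      using i by (simp add: sublinear_scaleR[OF N])
    also have "\<dots> \<le> N (x + t *\<^sub>R (k - z)) + N (- x)"
      using sublinear_add[OF N, of "x + t *\<^sub>R (k - z)" "- x"] by simp
    finally show "- N x \<le> \<sigma> i x"
      by (simp add: i \<sigma>_def sym)
  qed
  have "sublinear q"
    unfolding q_def
  proof (rule sublinear_INF[OF _ bdd])
    show "I \<noteq> {}"
      using K by (auto simp: I_def)
    fix i j x y assume "i \<in> I" "j \<in> I"
    then obtain t k u l where ij: "i = (t, k)" "0 \<le> t" "k \<in> K" "j = (u, l)" "0 \<le> u" "l \<in> K"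
      by (auto simp: I_def)
    obtain w where w: "w \<in> K" "t *\<^sub>R k + u *\<^sub>R l = (t + u) *\<^sub>R w"
      using convex_cone_sum[OF K(1), of k l t u] ij by metis
    have "(x + y) + (t + u) *\<^sub>R (w - z) = (x + t *\<^sub>R (k - z)) + (y + u *\<^sub>R (l - z))"
      using w(2) by (simp add: algebra_simps)
    then have "\<sigma> (t + u, w) (x + y) \<le> \<sigma> i x + \<sigma> j y"
      using sublinear_add[OF N, of "x + t *\<^sub>R (k - z)" "y + u *\<^sub>R (l - z)"]
      by (simp add: \<sigma>_def ij algebra_simps)
    moreover have "(t + u, w) \<in> I"
      using ij w by (auto simp: I_def)
    ultimately show "\<exists>k\<in>I. \<sigma> k (x + y) \<le> \<sigma> i x + \<sigma> j y"
      by blast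
  next
    fix i x and c :: real assume "i \<in> I" "0 < c"
    then obtain t k where i: "i = (t, k)" "0 \<le> t" "k \<in> K"
      by (auto simp: I_def)
    have "\<sigma> (c * t, k) (c *\<^sub>R x) = c * \<sigma> i x"
      using sublinear_scaleR[OF N, of c "x + t *\<^sub>R (k - z)"] \<open>0 < c\<close>
      by (simp add: \<sigma>_def i algebra_simps)
    moreover have "(c * t, k) \<in> I"
      using i \<open>0 < c\<close> by (auto simp: I_def)
    ultimately show "\<exists>k\<in>I. \<sigma> k (c *\<^sub>R x) \<le> c * \<sigma> i x"
      by (metis order_refl)
  qed
  then obtain \<Phi> where \<Phi>: "linear \<Phi>" "\<And>x. \<Phi> x \<le> q x"
    using hahn_banach_sublinear by blast
  have bound: "\<Phi> x \<le> N x" for x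
  proof -
    obtain k where "k \<in> K"
      using K by blast
    then have "q x \<le> \<sigma> (0, k) x"
      unfolding q_def by (intro cINF_lower[OF bdd]) (auto simp: I_def)
    with \<Phi>(2)[of x] show ?thesis
      by (simp add: \<sigma>_def)
  qed
  have "\<Phi> z + d \<le> \<Phi> k" if "k \<in> K" for k
  proof -
    have "q (z - k) \<le> \<sigma> (1, k) (z - k)"
      unfolding q_def using that by (intro cINF_lower[OF bdd]) (auto simp: I_def)
    with \<Phi>(2)[of "z - k"] show ?thesis
      by (simp add: \<sigma>_def linear_diff[OF \<Phi>(1)] sublinear_zero[OF N])
  qed
  moreover have "\<bar>\<Phi> x\<bar> \<le> N x" for x
    using bound[of x] bound[of "- x"] by (simp add: linear_neg[OF \<Phi>(1)] sym abs_le_iff)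
  ultimately show ?thesis
    using that \<Phi>(1) by blast
qed

text \<open>A linear projection onto \<open>V\<close> extends \<open>N\<close> from \<open>V\<close> to the whole space. This form is needed since
  \<open>L\<^sup>p\<close> is not a type but a subspace of the space of all functions.\<close>

lemma separate_point_convex_subspace:
  fixes N :: "'v::real_vector \<Rightarrow> real"
  assumes V: "subspace V"
    and add: "\<And>x y. x \<in> V \<Longrightarrow> y \<in> V \<Longrightarrow> N (x + y) \<le> N x + N y"
    and scale: "\<And>c x. x \<in> V \<Longrightarrow> N (c *\<^sub>R x) = \<bar>c\<bar> * N x"
    and K: "convex K" "K \<noteq> {}" "K \<subseteq> V" and z: "z \<in> V" and far: "\<And>k. k \<in> K \<Longrightarrow> d \<le> N (k - z)"
  obtains \<Phi> where "linear \<Phi>" "\<And>x. x \<in> V \<Longrightarrow> \<bar>\<Phi> x\<bar> \<le> N x" "\<And>k. k \<in> K \<Longrightarrow> \<Phi> z + d \<le> \<Phi> k"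
proof -
  obtain P where P: "linear P" "range P \<subseteq> V" "\<And>v. v \<in> V \<Longrightarrow> P v = v"
    using linear_exists_left_inverse_on[of id V] V by (auto simp: linear_id)
  have PV: "P x \<in> V" for x
    using P(2) by blast
  have "sublinear (\<lambda>x. N (P x))"
    unfolding sublinear_def
    by (simp add: linear_add[OF P(1)] linear_scale[OF P(1)] add scale PV)
  moreover have "N (P (- x)) = N (P x)" for x
    using scale[OF PV, of "- 1" x] by (simp add: linear_neg[OF P(1)])
  moreover have "d \<le> N (P (k - z))" if "k \<in> K" for k
  proof -
    have "k - z \<in> V"
      using that K z by (intro subspace_diff[OF V]) auto
    with far[OF that] show ?thesis
      by (simp add: P(3))
  qed
  ultimately obtain \<Phi> where "linear \<Phi>" "\<And>x. \<bar>\<Phi> x\<bar> \<le> N (P x)" "\<And>k. k \<in> K \<Longrightarrow> \<Phi> z + d \<le> \<Phi> k"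
    using separate_point_convex[of "\<lambda>x. N (P x)" K d z] K by blast
  with that P(3) show ?thesis
    by metis
qed

section \<open>The space \<open>L\<^sup>p\<close>\<close>

text \<open>Pointwise scalar multiplication makes \<open>L\<^sup>p\<close> a subspace in the sense of \<^const>\<open>subspace\<close> and
  gives access to \<^const>\<open>hull\<close> for convex combinations of functions.\<close>

instantiation "fun" :: (type, real_vector) real_vector
begin

definition scaleR_fun :: "real \<Rightarrow> ('a \<Rightarrow> 'b) \<Rightarrow> 'a \<Rightarrow> 'b" where
  "c *\<^sub>R f = (\<lambda>x. c *\<^sub>R f x)"

instance
  by standard (simp_all add: scaleR_fun_def fun_eq_iff algebra_simps)

end

lemma scaleR_fun_apply [simp]: "(c *\<^sub>R f) x = c *\<^sub>R f x"
  by (simp add: scaleR_fun_def)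

text \<open>Convexity of \<open>t powr p\<close> up to and including the endpoint \<open>t = 0\<close>, where a vanishing argument
  leaves the inequality \<open>w powr p \<le> w\<close> for a weight \<open>w \<le> 1\<close>.\<close>

lemma powr_convex_combination:
  fixes u v a b p :: real
  assumes p: "1 \<le> p" and uv: "0 < u" "0 < v" "u + v = 1" and ab: "0 \<le> a" "0 \<le> b"
  shows "(u * a + v * b) powr p \<le> u * a powr p + v * b powr p"
proof -
  have le1: "w powr p \<le> w" if "0 < w" "w \<le> 1" for w :: real
    using powr_mono'[of 1 p w] that p by simp
  consider "a = 0" | "b = 0" | "0 < a" "0 < b"
    using ab by fastforce
  then show ?thesis
  proof cases
    case 1
    then show ?thesis
      using uv ab le1[of v] p by (simp add: powr_mult mult_right_mono)
  next
    case 2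
    then show ?thesis
      using uv ab le1[of u] p by (simp add: powr_mult mult_right_mono)
  next
    case 3
    have "((1 - v) * a + v * b) powr p \<le> (1 - v) * a powr p + v * b powr p"
      using convex_onD[OF powr_convex[OF p], of v a b] uv 3 by simp
    moreover have "1 - v = u"
      using uv by simp
    ultimately show ?thesis
      by (simp only:)
  qed
qed

lemma LpD:
  assumes "f \<in> Lp p M"
  shows "f \<in> borel_measurable M" "integrable M (\<lambda>x. \<bar>f x\<bar> powr p)"
  using assms by (auto simp: Lp_def)

lemma Lp_norm_nonneg [simp]: "0 \<le> Lp_norm p M f"
  by (simp add: Lp_norm_def)

lemma Lp_norm_powr:
  assumes "0 < p"
  shows "Lp_norm p M f powr p = (\<integral>x. \<bar>f x\<bar> powr p \<partial>M)"
proof -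
  have "0 \<le> (\<integral>x. \<bar>f x\<bar> powr p \<partial>M)"
    by (intro integral_nonneg_AE) auto
  then show ?thesis
    using assms by (simp add: Lp_norm_def powr_powr)
qed

lemma Lp_norm_le_iff:
  assumes "0 < p" "0 \<le> t"
  shows "Lp_norm p M f \<le> t \<longleftrightarrow> (\<integral>x. \<bar>f x\<bar> powr p \<partial>M) \<le> t powr p"
  unfolding Lp_norm_powr[OF assms(1), symmetric]
  using assms powr_mono2[of p "Lp_norm p M f" t] powr_less_mono2[of p t "Lp_norm p M f"]
  by (auto simp: not_le[symmetric])

lemma Lp_scaleR:
  assumes p: "0 < p" and f: "f \<in> Lp p M"
  shows "c *\<^sub>R f \<in> Lp p M" and "Lp_norm p M (c *\<^sub>R f) = \<bar>c\<bar> * Lp_norm p M f"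
proof -
  have eq: "\<bar>(c *\<^sub>R f) x\<bar> powr p = \<bar>c\<bar> powr p * \<bar>f x\<bar> powr p" for x
    by (simp add: abs_mult powr_mult)
  show "c *\<^sub>R f \<in> Lp p M"
    using LpD[OF f] unfolding Lp_def mem_Collect_eq eq by (simp add: scaleR_fun_def)
  have "0 \<le> (\<integral>x. \<bar>f x\<bar> powr p \<partial>M)"
    by (intro integral_nonneg_AE) auto
  then show "Lp_norm p M (c *\<^sub>R f) = \<bar>c\<bar> * Lp_norm p M f"
    using p unfolding Lp_norm_def eq by (simp add: powr_mult powr_powr)
qed

text \<open>Convexity for the weights \<open>s / (s + t)\<close> and \<open>t / (s + t)\<close>. Integrated with \<open>s\<close> and \<open>t\<close> slightly
  above the norms of two functions, it becomes the triangle inequality.\<close>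

lemma abs_add_powr_le:
  fixes x y s t p :: real
  assumes "1 \<le> p" "0 < s" "0 < t"
  shows "\<bar>x + y\<bar> powr p \<le>
    (s + t) powr p * (s / (s + t) * (\<bar>x\<bar> powr p / s powr p) + t / (s + t) * (\<bar>y\<bar> powr p / t powr p))"
proof -
  have "\<bar>x + y\<bar> powr p \<le> (\<bar>x\<bar> + \<bar>y\<bar>) powr p"
    using assms by (intro powr_mono2) auto
  also have "\<bar>x\<bar> + \<bar>y\<bar> = (s + t) * (s / (s + t) * (\<bar>x\<bar> / s) + t / (s + t) * (\<bar>y\<bar> / t))"
    using assms by (simp add: add_divide_distrib[symmetric])
  also have "\<dots> powr p = (s + t) powr p * (s / (s + t) * (\<bar>x\<bar> / s) + t / (s + t) * (\<bar>y\<bar> / t)) powr p"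
    using assms by (simp add: powr_mult)
  also have "\<dots> \<le> (s + t) powr p * (s / (s + t) * (\<bar>x\<bar> / s) powr p + t / (s + t) * (\<bar>y\<bar> / t) powr p)"
    using assms
    by (intro mult_left_mono powr_convex_combination) (auto simp: add_divide_distrib[symmetric])
  finally show ?thesis
    using assms by (simp add: powr_divide)
qed

lemma Lp_add:
  assumes p: "1 \<le> p" and f: "f \<in> Lp p M" and g: "g \<in> Lp p M"
  shows "f + g \<in> Lp p M"
proof -
  note [measurable] = LpD(1)[OF f] LpD(1)[OF g]
  have "integrable M (\<lambda>x. \<bar>f x + g x\<bar> powr p)"
    by (rule Bochner_Integration.integrable_bound[OF _ _ AE_I2,
          of M "\<lambda>x. (1 + 1) powr p * (1 / (1 + 1) * (\<bar>f x\<bar> powr p / 1 powr p)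
                + 1 / (1 + 1) * (\<bar>g x\<bar> powr p / 1 powr p))"])
      (use LpD(2)[OF f] LpD(2)[OF g] abs_add_powr_le[OF p, of 1 1] in
        \<open>auto intro!: order_trans[OF _ abs_ge_self]\<close>)
  then show ?thesis
    by (simp add: Lp_def plus_fun_def)
qed

lemma Lp_norm_triangle:
  assumes p: "1 \<le> p" and f: "f \<in> Lp p M" and g: "g \<in> Lp p M"
  shows "Lp_norm p M (f + g) \<le> Lp_norm p M f + Lp_norm p M g"
proof (rule field_le_epsilon)
  fix e :: real assume e: "0 < e"
  define s where "s = Lp_norm p M f + e / 2"
  define t where "t = Lp_norm p M g + e / 2"
  have st: "0 < s" "0 < t"
    using e by (auto simp: s_def t_def add_nonneg_pos)
  have fs: "(\<integral>x. \<bar>f x\<bar> powr p \<partial>M) / s powr p \<le> 1"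
    using Lp_norm_le_iff[of p s M f] p st e by (simp add: s_def)
  have gt: "(\<integral>x. \<bar>g x\<bar> powr p \<partial>M) / t powr p \<le> 1"
    using Lp_norm_le_iff[of p t M g] p st e by (simp add: t_def)
  have "(\<integral>x. \<bar>(f + g) x\<bar> powr p \<partial>M)
      \<le> (\<integral>x. (s + t) powr p * (s / (s + t) * (\<bar>f x\<bar> powr p / s powr p) + t / (s + t) * (\<bar>g x\<bar> powr p / t powr p)) \<partial>M)"
    using LpD(2)[OF Lp_add[OF p f g]] LpD(2)[OF f] LpD(2)[OF g] abs_add_powr_le[OF p st]
    by (intro integral_mono) auto
  also have "\<dots> = (s + t) powr p * (s / (s + t) * ((\<integral>x. \<bar>f x\<bar> powr p \<partial>M) / s powr p)
      + t / (s + t) * ((\<integral>x. \<bar>g x\<bar> powr p \<partial>M) / t powr p))"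
    using LpD(2)[OF f] LpD(2)[OF g] by (simp only: Bochner_Integration.integral_mult_right_zero
        Bochner_Integration.integral_add Bochner_Integration.integral_divide_zero
        Bochner_Integration.integrable_mult_right Bochner_Integration.integrable_divide)
  also have "\<dots> \<le> (s + t) powr p * (s / (s + t) * 1 + t / (s + t) * 1)"
    using st fs gt by (intro mult_left_mono add_mono) auto
  also have "\<dots> = (s + t) powr p"
    using st by (simp add: add_divide_distrib[symmetric])
  finally have "Lp_norm p M (f + g) \<le> s + t"
    using p st by (subst Lp_norm_le_iff) auto
  then show "Lp_norm p M (f + g) \<le> Lp_norm p M f + Lp_norm p M g + e"
    by (simp add: s_def t_def)
qed

lemma subspace_Lp:
  assumes p: "1 \<le> p"
  shows "subspace (Lp p M)"
  unfolding subspace_def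
  using p by (auto intro: Lp_add Lp_scaleR) (simp add: Lp_def zero_fun_def)

lemma Lp_diff:
  assumes p: "1 \<le> p" and f: "f \<in> Lp p M" and g: "g \<in> Lp p M"
  shows "f - g \<in> Lp p M"
  using subspace_diff[OF subspace_Lp[OF p] f g] .

lemma linear_bounded_in_Lp_dual:
  assumes "linear \<Phi>" and "\<And>h. h \<in> Lp p M \<Longrightarrow> \<bar>\<Phi> h\<bar> \<le> C * Lp_norm p M h"
  shows "\<Phi> \<in> Lp_dual p M"
  using assms(2) linear_add[OF assms(1)] linear_scale[OF assms(1)]
  unfolding Lp_dual_def plus_fun_def scaleR_fun_def by auto

text \<open>Mazur's lemma: if all convex combinations kept distance \<open>d\<close> from \<open>f\<close>, a separating functional
  would contradict weak convergence.\<close>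

lemma mazur_Lp:
  assumes p: "1 \<le> p" and F: "\<And>i. F i \<in> Lp p M" and f: "f \<in> Lp p M"
    and weak: "weakly_converges_Lp p M F f" and d: "0 < d"
  obtains g where "g \<in> convex hull (F ` {j..})" "Lp_norm p M (g - f) < d"
proof (rule ccontr)
  assume "\<not> thesis"
  with that have far: "\<And>g. g \<in> convex hull (F ` {j..}) \<Longrightarrow> d \<le> Lp_norm p M (g - f)"
    using not_less by blast
  have sub: "convex hull (F ` {j..}) \<subseteq> Lp p M"
    using F by (intro hull_minimal subspace_imp_convex subspace_Lp p) auto
  have p0: "0 < p"
    using p by simp
  have ne: "convex hull (F ` {j..}) \<noteq> {}"
    by auto
  obtain \<Phi> where \<Phi>: "linear \<Phi>" "\<And>h. h \<in> Lp p M \<Longrightarrow> \<bar>\<Phi> h\<bar> \<le> Lp_norm p M h"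
    "\<And>g. g \<in> convex hull (F ` {j..}) \<Longrightarrow> \<Phi> f + d \<le> \<Phi> g"
    using separate_point_convex_subspace[where N = "Lp_norm p M" and d = d,
        OF subspace_Lp[OF p] Lp_norm_triangle[OF p]
        Lp_scaleR(2)[OF p0] convex_convex_hull ne sub f far] by blast
  have "\<Phi> \<in> Lp_dual p M"
    using \<Phi>(2) by (intro linear_bounded_in_Lp_dual[OF \<Phi>(1), where C = 1]) auto
  then have "(\<lambda>i. \<Phi> (F i)) \<longlonglongrightarrow> \<Phi> f"
    using weak by (simp add: weakly_converges_Lp_def)
  moreover have "\<forall>i\<ge>j. \<Phi> f + d \<le> \<Phi> (F i)"
    using \<Phi>(3) by (auto intro: hull_inc)
  ultimately have "\<Phi> f + d \<le> \<Phi> f"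
    by (meson LIMSEQ_le_const)
  with d show False
    by simp
qed

lemma Lp_sum:
  fixes u :: "nat \<Rightarrow> 'a \<Rightarrow> real"
  assumes p: "1 \<le> p" and u: "\<And>n. u n \<in> Lp p M"
  shows "(\<lambda>x. \<Sum>n<N. \<bar>u n x\<bar>) \<in> Lp p M \<and>
    Lp_norm p M (\<lambda>x. \<Sum>n<N. \<bar>u n x\<bar>) \<le> (\<Sum>n<N. Lp_norm p M (u n))"
proof (induction N)
  case 0
  then show ?case
    using p by (simp add: Lp_def Lp_norm_def)
next
  case (Suc N)
  have a: "(\<lambda>x. \<bar>u N x\<bar>) \<in> Lp p M" "Lp_norm p M (\<lambda>x. \<bar>u N x\<bar>) = Lp_norm p M (u N)"
    using u[of N] by (auto simp: Lp_def Lp_norm_def)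
  have "(\<lambda>x. \<Sum>n<Suc N. \<bar>u n x\<bar>) = (\<lambda>x. \<Sum>n<N. \<bar>u n x\<bar>) + (\<lambda>x. \<bar>u N x\<bar>)"
    by (auto simp: fun_eq_iff)
  then show ?case
    using Lp_add[OF p conjunct1[OF Suc] a(1)] Lp_norm_triangle[OF p conjunct1[OF Suc] a(1)] Suc a
    by simp
qed

text \<open>The half of the Riesz-Fischer theorem that produces a majorant: monotone convergence bounds
  the \<open>p\<close>-th power of the supremum of the partial sums, so these are bounded almost everywhere.\<close>

lemma Lp_absolutely_convergent:
  fixes u :: "nat \<Rightarrow> 'a \<Rightarrow> real"
  assumes p: "1 \<le> p" and u: "\<And>n. u n \<in> Lp p M" and sm: "summable (\<lambda>n. Lp_norm p M (u n))"
  shows "(\<lambda>x. \<Sum>n. \<bar>u n x\<bar>) \<in> Lp_plus p M" and "AE x in M. summable (\<lambda>n. \<bar>u n x\<bar>)"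
proof -
  define S where "S N x = (\<Sum>n<N. \<bar>u n x\<bar>)" for N x
  define C where "C = (\<Sum>n. Lp_norm p M (u n)) powr p"
  note [measurable] = LpD(1)[OF u]
  have S_meas [measurable]: "S N \<in> borel_measurable M" for N
    unfolding S_def by measurable
  have S_nonneg: "0 \<le> S N x" for N x
    unfolding S_def by (intro sum_nonneg) auto
  have S_mono: "S N x \<le> S N' x" if "N \<le> N'" for N N' x
    unfolding S_def using that by (intro sum_mono2) auto
  have le_C: "(\<integral>\<^sup>+x. ennreal (S N x powr p) \<partial>M) \<le> ennreal C" for N
  proof -
    have SN: "S N \<in> Lp p M" "Lp_norm p M (S N) \<le> (\<Sum>n<N. Lp_norm p M (u n))"
      using Lp_sum[where u = u and N = N, OF p u] by (auto simp: S_def[abs_def])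
    have "(\<integral>\<^sup>+x. ennreal (S N x powr p) \<partial>M) = ennreal (\<integral>x. \<bar>S N x\<bar> powr p \<partial>M)"
      using LpD(2)[OF SN(1)] S_nonneg by (subst nn_integral_eq_integral[symmetric]) auto
    also have "(\<integral>x. \<bar>S N x\<bar> powr p \<partial>M) = Lp_norm p M (S N) powr p"
      using p by (simp add: Lp_norm_powr)
    also have "\<dots> \<le> C"
      unfolding C_def using SN(2) p sum_le_suminf[OF sm, where I = "{..<N}"]
      by (intro powr_mono2) auto
    finally show ?thesis
      by (simp add: ennreal_leI)
  qed
  have "(\<integral>\<^sup>+x. (SUP N. ennreal (S N x powr p)) \<partial>M) = (SUP N. \<integral>\<^sup>+x. ennreal (S N x powr p) \<partial>M)"
    using S_mono S_nonneg p
    by (intro nn_integral_monotone_convergence_SUP)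
       (auto simp: incseq_def le_fun_def intro!: ennreal_leI powr_mono2)
  also have "\<dots> \<le> ennreal C"
    by (intro SUP_least le_C)
  finally have int_C: "(\<integral>\<^sup>+x. (SUP N. ennreal (S N x powr p)) \<partial>M) \<le> ennreal C" .
  then have "(\<integral>\<^sup>+x. (SUP N. ennreal (S N x powr p)) \<partial>M) \<noteq> \<infinity>"
    using ennreal_less_top[of C] by (auto simp: top_unique)
  then have fin: "AE x in M. (SUP N. ennreal (S N x powr p)) \<noteq> \<infinity>"
    by (intro nn_integral_PInf_AE) auto
  have sm_pt: "summable (\<lambda>n. \<bar>u n x\<bar>)" if "(SUP N. ennreal (S N x powr p)) \<noteq> \<infinity>" for x
  proof -
    obtain r where r: "0 \<le> r" "(SUP N. ennreal (S N x powr p)) = ennreal r"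
      using \<open>(SUP N. ennreal (S N x powr p)) \<noteq> \<infinity>\<close> by (cases "SUP N. ennreal (S N x powr p)") auto
    have "S N x powr p \<le> r" for N
    proof -
      have "ennreal (S N x powr p) \<le> ennreal r"
        unfolding r(2)[symmetric] by (rule SUP_upper) simp
      then show ?thesis
        using r(1) by (simp add: ennreal_le_iff)
    qed
    then have "(S N x powr p) powr (1 / p) \<le> r powr (1 / p)" for N
      using p by (intro powr_mono2) auto
    then have "\<bar>S N x\<bar> \<le> r powr (1 / p)" for N
      using p by (simp add: powr_powr)
    then have "S N x \<le> r powr (1 / p)" for N
      by (rule order_trans[OF abs_ge_self])
    then show ?thesis
      unfolding S_def by (intro summableI_nonneg_bounded) auto
  qed
  with fin show ae: "AE x in M. summable (\<lambda>n. \<bar>u n x\<bar>)"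
    by (auto elim: eventually_mono)
  have le_SUP: "ennreal (\<bar>\<Sum>n. \<bar>u n x\<bar>\<bar> powr p) \<le> (SUP N. ennreal (S N x powr p))"
    if "summable (\<lambda>n. \<bar>u n x\<bar>)" for x
  proof -
    have "(\<lambda>N. S N x) \<longlonglongrightarrow> (\<Sum>n. \<bar>u n x\<bar>)"
      unfolding S_def using summable_LIMSEQ[OF that] .
    then have "(\<lambda>N. \<bar>S N x\<bar> powr p) \<longlonglongrightarrow> \<bar>\<Sum>n. \<bar>u n x\<bar>\<bar> powr p"
      using p by (intro tendsto_powr' tendsto_rabs tendsto_const) auto
    then have "(\<lambda>N. ennreal (S N x powr p)) \<longlonglongrightarrow> ennreal (\<bar>\<Sum>n. \<bar>u n x\<bar>\<bar> powr p)"
      using S_nonneg by (simp add: tendsto_ennrealI)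
    then show ?thesis
      by (rule LIMSEQ_le_const2) (intro exI allI impI SUP_upper UNIV_I)
  qed
  have "(\<integral>\<^sup>+x. ennreal (\<bar>\<Sum>n. \<bar>u n x\<bar>\<bar> powr p) \<partial>M) \<le> (\<integral>\<^sup>+x. (SUP N. ennreal (S N x powr p)) \<partial>M)"
    using ae le_SUP by (intro nn_integral_mono_AE) (auto elim: eventually_mono)
  also note int_C
  finally have "(\<integral>\<^sup>+x. ennreal (\<bar>\<Sum>n. \<bar>u n x\<bar>\<bar> powr p) \<partial>M) < \<infinity>"
    using ennreal_less_top[of C] by (auto intro: le_less_trans)
  then have "integrable M (\<lambda>x. \<bar>\<Sum>n. \<bar>u n x\<bar>\<bar> powr p)"
    by (intro integrableI_bounded) auto
  moreover have "AE x in M. 0 \<le> (\<Sum>n. \<bar>u n x\<bar>)"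
    using ae by eventually_elim (auto intro: suminf_nonneg)
  ultimately show "(\<lambda>x. \<Sum>n. \<bar>u n x\<bar>) \<in> Lp_plus p M"
    by (simp add: Lp_plus_def Lp_def)
qed

text \<open>A bounded kernel supported in a set of finite measure defines a bounded functional. The
  bound comes from the elementary inequality \<open>r \<le> 1 + r powr p\<close> for \<open>r = \<bar>u x\<bar> / t\<close>, with \<open>t\<close>
  slightly above the norm of \<open>u\<close>.\<close>

lemma integral_bounded_Lp:
  assumes p: "1 \<le> p" and u: "u \<in> Lp p M" and A: "A \<in> sets M" "emeasure M A < \<infinity>"
    and h [measurable]: "h \<in> borel_measurable M"
    and bound: "\<And>x. \<bar>h x\<bar> \<le> B * indicator A x" and B: "0 \<le> B"
  shows "integrable M (\<lambda>x. u x * h x)"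
    and "\<bar>\<integral>x. u x * h x \<partial>M\<bar> \<le> B * (measure M A + 1) * Lp_norm p M u"
proof -
  note [measurable] = LpD(1)[OF u] A(1)
  have ptw: "\<bar>u x * h x\<bar> \<le> B * (t * (indicator A x + \<bar>u x\<bar> powr p / t powr p))" if t: "0 < t" for x t
  proof -
    have "\<bar>u x\<bar> / t \<le> 1 + (\<bar>u x\<bar> / t) powr p"
    proof (cases "\<bar>u x\<bar> / t \<le> 1")
      case True
      then show ?thesis
        by (simp add: add_increasing2)
    next
      case False
      then have "(\<bar>u x\<bar> / t) powr 1 \<le> (\<bar>u x\<bar> / t) powr p"
        using p by (intro powr_mono) auto
      then show ?thesis
        using False t by simp
    qed
    then have "\<bar>u x\<bar> \<le> t * (1 + \<bar>u x\<bar> powr p / t powr p)"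
      using t by (simp add: powr_divide field_simps)
    then have "\<bar>u x\<bar> * indicator A x \<le> t * (indicator A x + \<bar>u x\<bar> powr p / t powr p)"
      using t by (auto simp: indicator_def)
    then have "B * (\<bar>u x\<bar> * indicator A x) \<le> B * (t * (indicator A x + \<bar>u x\<bar> powr p / t powr p))"
      using B by (rule mult_left_mono)
    moreover have "\<bar>u x * h x\<bar> \<le> B * (\<bar>u x\<bar> * indicator A x)"
      using mult_left_mono[OF bound[of x] abs_ge_zero[of "u x"]] by (simp add: abs_mult mult_ac)
    ultimately show ?thesis
      by simp
  qed
  have int_bd: "integrable M (\<lambda>x. B * (t * (indicator A x + \<bar>u x\<bar> powr p / t powr p)))" for t
    using A LpD(2)[OF u] by auto
  show int: "integrable M (\<lambda>x. u x * h x)"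
    using ptw[of 1] by (intro Bochner_Integration.integrable_bound[OF int_bd[of 1]])
      (auto intro!: order_trans[OF _ abs_ge_self])
  show "\<bar>\<integral>x. u x * h x \<partial>M\<bar> \<le> B * (measure M A + 1) * Lp_norm p M u"
  proof (rule field_le_epsilon)
    fix e :: real assume e: "0 < e"
    define C where "C = B * (measure M A + 1)"
    define t where "t = Lp_norm p M u + e / (C + 1)"
    have C: "0 \<le> C"
      using B by (simp add: C_def)
    have t: "0 < t" "Lp_norm p M u \<le> t"
      using C e by (auto simp: t_def add_nonneg_pos)
    have "(\<integral>x. \<bar>u x\<bar> powr p \<partial>M) / t powr p \<le> 1"
      using Lp_norm_le_iff[of p t M u] p t by simp
    have "\<bar>\<integral>x. u x * h x \<partial>M\<bar> \<le> (\<integral>x. \<bar>u x * h x\<bar> \<partial>M)"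
      by simp
    also have "\<dots> \<le> (\<integral>x. B * (t * (indicator A x + \<bar>u x\<bar> powr p / t powr p)) \<partial>M)"
      using int int_bd ptw[OF t(1)] by (intro integral_mono) auto
    also have "\<dots> = B * (t * (measure M A + (\<integral>x. \<bar>u x\<bar> powr p \<partial>M) / t powr p))"
      using A LpD(2)[OF u] by simp
    also have "\<dots> \<le> B * (t * (measure M A + 1))"
      using B t \<open>_ \<le> 1\<close> by (intro mult_left_mono add_left_mono) auto
    also have "\<dots> = C * Lp_norm p M u + C * (e / (C + 1))"
      by (simp add: C_def t_def algebra_simps)
    also have "C * (e / (C + 1)) \<le> e"
      using C e by (simp add: field_simps)
    finally show "\<bar>\<integral>x. u x * h x \<partial>M\<bar> \<le> B * (measure M A + 1) * Lp_norm p M u + e"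
      by (simp add: C_def)
  qed
qed

section \<open>Convex combinations of tails\<close>

text \<open>The bridge from convex combinations back to the sequence itself: a convex combination of
  numbers from the \<open>j\<close>-th tail lies between the infimum and the supremum of that tail.\<close>

lemma convex_hull_tail_limit:
  fixes a b :: "nat \<Rightarrow> real"
  assumes hull: "\<And>j. b j \<in> convex hull (a ` {j..})" and lim: "b \<longlonglongrightarrow> \<beta>"
  shows "liminf (\<lambda>i. ereal (a i)) \<le> ereal \<beta>" and "ereal \<beta> \<le> limsup (\<lambda>i. ereal (a i))"
proof -
  have lim': "(\<lambda>j. ereal (b j)) \<longlonglongrightarrow> ereal \<beta>"
    using lim by simp
  have interval: "b j \<in> S" if "is_interval S" "a ` {n..} \<subseteq> S" "n \<le> j" for S n j
  proof -
    have "a ` {j..} \<subseteq> S"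
      using that by auto
    then have "convex hull (a ` {j..}) \<subseteq> S"
      using that by (intro hull_minimal is_interval_convex)
    with hull show ?thesis by blast
  qed
  show "liminf (\<lambda>i. ereal (a i)) \<le> ereal \<beta>"
    unfolding liminf_SUP_INF
  proof (rule SUP_least)
    fix n
    have "(INF i\<in>{n..}. ereal (a i)) \<le> ereal (b j)" if "n \<le> j" for j
    proof -
      have "b j \<in> {r. (INF i\<in>{n..}. ereal (a i)) \<le> ereal r}"
        using that by (intro interval[of _ n])
          (auto simp: is_interval_1 intro: INF_lower order_trans)
      then show ?thesis by simp
    qed
    then show "(INF i\<in>{n..}. ereal (a i)) \<le> ereal \<beta>"
      by (intro LIMSEQ_le_const[OF lim']) auto
  qed
  show "ereal \<beta> \<le> limsup (\<lambda>i. ereal (a i))"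
    unfolding limsup_INF_SUP
  proof (rule INF_greatest)
    fix n
    have "ereal (b j) \<le> (SUP i\<in>{n..}. ereal (a i))" if "n \<le> j" for j
    proof -
      have "b j \<in> {r. ereal r \<le> (SUP i\<in>{n..}. ereal (a i))}"
        using that by (intro interval[of _ n])
          (auto simp: is_interval_1 intro: SUP_upper order_trans[rotated])
      then show ?thesis by simp
    qed
    then show "ereal \<beta> \<le> (SUP i\<in>{n..}. ereal (a i))"
      by (intro LIMSEQ_le_const2[OF lim']) auto
  qed
qed

lemma integral_convex_hull:
  fixes k :: "'a \<Rightarrow> real"
  assumes S: "\<And>s. s \<in> S \<Longrightarrow> integrable M (\<lambda>y. s y * k y)" and g: "g \<in> convex hull S"
  shows "integrable M (\<lambda>y. g y * k y)"
    and "(\<integral>y. g y * k y \<partial>M) \<in> convex hull ((\<lambda>s. \<integral>y. s y * k y \<partial>M) ` S)"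
proof -
  let ?T = "{s. integrable M (\<lambda>y. s y * k y) \<and>
      (\<integral>y. s y * k y \<partial>M) \<in> convex hull ((\<lambda>s. \<integral>y. s y * k y \<partial>M) ` S)}"
  have "convex ?T"
  proof (rule convexI)
    fix x y u v assume xy: "x \<in> ?T" "y \<in> ?T" and uv: "0 \<le> u" "0 \<le> v" "u + v = (1::real)"
    have eq: "(u *\<^sub>R x + v *\<^sub>R y) z * k z = u * (x z * k z) + v * (y z * k z)" for z
      by (simp add: algebra_simps)
    have "(\<integral>z. (u *\<^sub>R x + v *\<^sub>R y) z * k z \<partial>M)
        = u *\<^sub>R (\<integral>z. x z * k z \<partial>M) + v *\<^sub>R (\<integral>z. y z * k z \<partial>M)"
      unfolding eq using xy by simp
    also have "\<dots> \<in> convex hull ((\<lambda>s. \<integral>y. s y * k y \<partial>M) ` S)"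
      using xy uv by (intro convexD) auto
    finally show "u *\<^sub>R x + v *\<^sub>R y \<in> ?T"
      using xy unfolding mem_Collect_eq eq by auto
  qed
  moreover have "S \<subseteq> ?T"
    using S by (auto intro: hull_inc)
  ultimately have "convex hull S \<subseteq> ?T"
    by (intro hull_minimal)
  with g show "integrable M (\<lambda>y. g y * k y)"
    "(\<integral>y. g y * k y \<partial>M) \<in> convex hull ((\<lambda>s. \<integral>y. s y * k y \<partial>M) ` S)"
    by auto
qed

section \<open>Riesz potentials and sets of capacity zero\<close>

lemma borel_sets_cara:
  assumes "borel_regular_outer_measure \<mu>" "A \<in> sets borel"
  shows "A \<in> sets (cara \<mu>)" and "emeasure (cara \<mu>) A = \<mu> A"
proof -
  have oms: "outer_measure_space (UNIV :: 'a set set) \<mu>" and A: "A \<in> lambda_system UNIV UNIV \<mu>"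
    using assms by (auto simp: borel_regular_outer_measure_def)
  interpret sigma_algebra "UNIV :: 'a set" UNIV
    using sigma_algebra_Pow[of "UNIV :: 'a set"] by simp
  have ms: "measure_space UNIV (lambda_system UNIV UNIV \<mu>) \<mu>"
    by (rule caratheodory_lemma[OF oms])
  then have "sigma_sets UNIV (lambda_system UNIV UNIV \<mu>) = lambda_system UNIV UNIV \<mu>"
    by (intro sigma_algebra.sigma_sets_eq) (simp add: measure_space_def)
  then show "A \<in> sets (cara \<mu>)"
    using A by (simp add: cara_def)
  show "emeasure (cara \<mu>) A = \<mu> A"
    using ms A unfolding cara_def measure_space_def
    by (intro emeasure_measure_of_sigma) auto
qed

definition riesz_kernel :: "('a::metric_space set \<Rightarrow> ennreal) \<Rightarrow> real \<Rightarrow> 'a \<Rightarrow> 'a \<Rightarrow> real" where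
  "riesz_kernel \<mu> \<gamma> x y = 1 / enn2real (\<mu> (ball x (dist x y))) powr (1 - \<gamma>)"

lemma riesz_kernel_nonneg [simp]: "0 \<le> riesz_kernel \<mu> \<gamma> x y"
  by (simp add: riesz_kernel_def)

lemma riesz_pos_eq:
  "riesz_pos \<mu> \<gamma> f x = (\<integral>\<^sup>+ y. ennreal (f y * riesz_kernel \<mu> \<gamma> x y) \<partial>cara \<mu>)"
  by (simp add: riesz_pos_def riesz_kernel_def)

text \<open>The kernel is a function of \<open>r = dist x y\<close> through the monotone map
  \<open>r \<mapsto> \<mu> (ball x r)\<close>.\<close>

lemma riesz_kernel_measurable:
  fixes \<mu> :: "'a::metric_space set \<Rightarrow> ennreal"
  assumes \<mu>: "borel_regular_outer_measure \<mu>" and fin: "\<And>x r. 0 < r \<Longrightarrow> \<mu> (ball x r) < \<infinity>"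
  shows "riesz_kernel \<mu> \<gamma> x \<in> borel_measurable (cara \<mu>)"
proof -
  have mono_\<mu>: "\<mu> A \<le> \<mu> B" if "A \<subseteq> B" for A B
    using \<mu> that by (auto simp: borel_regular_outer_measure_def outer_measure_space_def increasing_def)
  have "\<mu> {} = 0"
    using \<mu> by (auto simp: borel_regular_outer_measure_def outer_measure_space_def positive_def)
  then have fin': "\<mu> (ball x r) < top" for r
    using fin[of r x] by (cases "0 < r") (auto simp: not_less ball_empty)
  have "mono (\<lambda>r. enn2real (\<mu> (ball x r)))"
    by (intro monoI enn2real_mono mono_\<mu> fin' subset_ball)
  then have [measurable]: "(\<lambda>r. enn2real (\<mu> (ball x r))) \<in> borel_measurable borel"
    by (rule borel_measurable_mono)
  have "dist x \<in> borel_measurable borel"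
    by (intro borel_measurable_continuous_onI continuous_intros)
  then have "(\<lambda>y. 1 / enn2real (\<mu> (ball x (dist x y))) powr (1 - \<gamma>)) \<in> borel_measurable borel"
    by measurable
  then have "riesz_kernel \<mu> \<gamma> x \<in> borel_measurable borel"
    by (simp add: riesz_kernel_def[abs_def])
  moreover have "id \<in> measurable (cara \<mu>) borel"
    using borel_sets_cara(1)[OF \<mu>] by (intro measurableI) (auto simp: cara_def)
  ultimately show ?thesis
    using measurable_comp[of id "cara \<mu>" borel "riesz_kernel \<mu> \<gamma> x" borel] by (simp only: comp_id)
qed

lemma riesz_potential_eq_integral:
  assumes int: "integrable (cara \<mu>) (\<lambda>y. f y * riesz_kernel \<mu> \<gamma> x y)"
  shows "riesz_defined \<mu> \<gamma> f x"
    and "riesz_potential \<mu> \<gamma> f x = ereal (\<integral>y. f y * riesz_kernel \<mu> \<gamma> x y \<partial>cara \<mu>)"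
proof -
  from int obtain r q where rq: "0 \<le> r" "0 \<le> q"
    "(\<integral>\<^sup>+y. ennreal (f y * riesz_kernel \<mu> \<gamma> x y) \<partial>cara \<mu>) = ennreal r"
    "(\<integral>\<^sup>+y. ennreal (- (f y * riesz_kernel \<mu> \<gamma> x y)) \<partial>cara \<mu>) = ennreal q"
    "(\<integral>y. f y * riesz_kernel \<mu> \<gamma> x y \<partial>cara \<mu>) = r - q"
    by (rule integrableE)
  then show "riesz_defined \<mu> \<gamma> f x"
    by (simp add: riesz_defined_def riesz_pos_eq)
  show "riesz_potential \<mu> \<gamma> f x = ereal (\<integral>y. f y * riesz_kernel \<mu> \<gamma> x y \<partial>cara \<mu>)"
    using rq by (simp add: riesz_potential_def riesz_pos_eq enn2ereal_ennreal)
qed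

lemma riesz_potential_Lp_plus:
  assumes "f \<in> Lp_plus p (cara \<mu>)"
  shows "riesz_potential \<mu> \<gamma> f x = enn2ereal (riesz_pos \<mu> \<gamma> f x)"
proof -
  have "AE y in cara \<mu>. 0 \<le> f y"
    using assms by (simp add: Lp_plus_def)
  then have "AE y in cara \<mu>. ennreal (- f y * riesz_kernel \<mu> \<gamma> x y) = 0"
    by eventually_elim (auto intro!: ennreal_neg)
  then have "riesz_pos \<mu> \<gamma> (\<lambda>y. - f y) x = 0"
    unfolding riesz_pos_eq by (subst nn_integral_cong_AE[where v = "\<lambda>_. 0"]) auto
  then show ?thesis
    by (simp add: riesz_potential_def zero_ennreal.rep_eq)
qed

text \<open>Every positive multiple of \<open>h\<close>, however small its norm, is admissible for \<open>E\<close>.\<close>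

lemma riesz_capacity_zero_if_potential_infinite:
  assumes p: "0 < p" and h: "h \<in> Lp_plus p (cara \<mu>)"
    and K: "\<And>x. riesz_kernel \<mu> \<gamma> x \<in> borel_measurable (cara \<mu>)"
    and inf: "\<And>x. x \<in> E \<Longrightarrow> riesz_pos \<mu> \<gamma> h x = \<infinity>"
  shows "riesz_capacity \<mu> \<gamma> p E = 0"
proof -
  have hLp: "h \<in> Lp p (cara \<mu>)" and h0: "AE y in cara \<mu>. 0 \<le> h y"
    using h by (auto simp: Lp_plus_def)
  note [measurable] = LpD(1)[OF hLp] K
  define N where "N = Lp_norm p (cara \<mu>) h"
  have "riesz_capacity \<mu> \<gamma> p E \<le> ennreal e" if e: "0 < e" for e
  proof -
    \<comment> \<open>The summand \<open>1\<close> keeps the denominator positive when \<open>h\<close> has norm \<open>0\<close>.\<close>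
    define c where "c = e powr (1 / p) / (N + 1)"
    have N: "0 \<le> N"
      by (simp add: N_def)
    then have c: "0 < c"
      using e by (simp add: c_def)
    have plus: "c *\<^sub>R h \<in> Lp_plus p (cara \<mu>)"
      using Lp_scaleR(1)[OF p hLp, of c] h0 c by (auto simp: Lp_plus_def elim: eventually_mono)
    have "riesz_pos \<mu> \<gamma> (c *\<^sub>R h) x = \<infinity>" if "x \<in> E" for x
    proof -
      have "riesz_pos \<mu> \<gamma> (c *\<^sub>R h) x
          = (\<integral>\<^sup>+y. ennreal c * ennreal (h y * riesz_kernel \<mu> \<gamma> x y) \<partial>cara \<mu>)"
        using c by (simp add: riesz_pos_eq ennreal_mult'[symmetric] mult.assoc)
      also have "\<dots> = ennreal c * riesz_pos \<mu> \<gamma> h x"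
        unfolding riesz_pos_eq by (intro nn_integral_cmult) measurable
      finally show ?thesis
        using inf[OF that] c by (simp add: ennreal_mult_top)
    qed
    then have "c *\<^sub>R h \<in> riesz_admissible \<mu> \<gamma> p E"
      using plus by (simp add: riesz_admissible_def riesz_potential_Lp_plus[OF plus])
    then have "riesz_capacity \<mu> \<gamma> p E \<le> ennreal (Lp_norm p (cara \<mu>) (c *\<^sub>R h) powr p)"
      unfolding riesz_capacity_def by (rule INF_lower)
    also have "Lp_norm p (cara \<mu>) (c *\<^sub>R h) = e powr (1 / p) * (N / (N + 1))"
      using c unfolding Lp_scaleR(2)[OF p hLp] by (simp add: c_def N_def)
    also have "\<dots> \<le> e powr (1 / p)"
      using N by (intro mult_left_le) auto
    then have "ennreal ((e powr (1 / p) * (N / (N + 1))) powr p) \<le> ennreal ((e powr (1 / p)) powr p)"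
      using N p by (intro ennreal_leI powr_mono2) auto
    also have "(e powr (1 / p)) powr p = e"
      using e p by (simp add: powr_powr)
    finally show ?thesis .
  qed
  then have "riesz_capacity \<mu> \<gamma> p E \<le> 0 + ennreal e" if "0 < e" for e
    unfolding add_0_left using that .
  then have "riesz_capacity \<mu> \<gamma> p E \<le> 0"
    by (rule ennreal_le_epsilon)
  then show ?thesis
    by simp
qed

text \<open>All exceptional sets are collected into one: where the potential of the single function
  \<open>\<Sum>n. \<bar>u n\<bar>\<close> is finite, the potentials of all \<open>\<bar>u n\<bar>\<close> are finite and form a summable
  sequence. In particular they tend to \<open>0\<close> there.\<close>

lemma riesz_series_quasi_everywhere:
  fixes u :: "nat \<Rightarrow> 'a::metric_space \<Rightarrow> real"
  assumes p: "1 \<le> p" and u: "\<And>n. u n \<in> Lp p (cara \<mu>)"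
    and sm: "summable (\<lambda>n. Lp_norm p (cara \<mu>) (u n))"
    and K: "\<And>x. riesz_kernel \<mu> \<gamma> x \<in> borel_measurable (cara \<mu>)"
  shows "quasi_everywhere \<mu> \<gamma> p (\<lambda>x.
    (\<forall>n. integrable (cara \<mu>) (\<lambda>y. u n y * riesz_kernel \<mu> \<gamma> x y)) \<and>
    summable (\<lambda>n. \<integral>y. \<bar>u n y * riesz_kernel \<mu> \<gamma> x y\<bar> \<partial>cara \<mu>))"
proof -
  define h where "h = (\<lambda>y. \<Sum>n. \<bar>u n y\<bar>)"
  have h: "h \<in> Lp_plus p (cara \<mu>)" and ae: "AE y in cara \<mu>. summable (\<lambda>n. \<bar>u n y\<bar>)"
    unfolding h_def using Lp_absolutely_convergent[OF p, of u] u sm by auto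
  note [measurable] = LpD(1)[OF u] K
  define E where "E = {x. riesz_pos \<mu> \<gamma> h x = \<infinity>}"
  have "riesz_capacity \<mu> \<gamma> p E = 0"
    using p by (intro riesz_capacity_zero_if_potential_infinite[OF _ h K]) (auto simp: E_def)
  moreover have "(\<forall>n. integrable (cara \<mu>) (\<lambda>y. u n y * riesz_kernel \<mu> \<gamma> x y)) \<and>
    summable (\<lambda>n. \<integral>y. \<bar>u n y * riesz_kernel \<mu> \<gamma> x y\<bar> \<partial>cara \<mu>)" if "x \<notin> E" for x
  proof -
    let ?w = "\<lambda>n y. u n y * riesz_kernel \<mu> \<gamma> x y"
    have "riesz_pos \<mu> \<gamma> h x = (\<integral>\<^sup>+y. (\<Sum>n. ennreal \<bar>?w n y\<bar>) \<partial>cara \<mu>)"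
      unfolding riesz_pos_eq
    proof (rule nn_integral_cong_AE)
      show "AE y in cara \<mu>. ennreal (h y * riesz_kernel \<mu> \<gamma> x y) = (\<Sum>n. ennreal \<bar>?w n y\<bar>)"
        using ae
      proof eventually_elim
        fix y assume s: "summable (\<lambda>n. \<bar>u n y\<bar>)"
        have "(\<Sum>n. ennreal \<bar>?w n y\<bar>) = ennreal (\<Sum>n. \<bar>u n y\<bar> * riesz_kernel \<mu> \<gamma> x y)"
          using summable_mult2[OF s] by (subst suminf_ennreal2[symmetric]) (auto simp: abs_mult)
        then show "ennreal (h y * riesz_kernel \<mu> \<gamma> x y) = (\<Sum>n. ennreal \<bar>?w n y\<bar>)"
          using suminf_mult2[OF s] by (simp add: h_def)
      qed
    qed
    also have "\<dots> = (\<Sum>n. \<integral>\<^sup>+y. ennreal \<bar>?w n y\<bar> \<partial>cara \<mu>)"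
      by (intro nn_integral_suminf) measurable
    finally have fin: "(\<Sum>n. \<integral>\<^sup>+y. ennreal \<bar>?w n y\<bar> \<partial>cara \<mu>) \<noteq> top"
      using that by (auto simp: E_def)
    have int: "integrable (cara \<mu>) (?w n)" for n
      unfolding integrable_iff_bounded
    proof
      have "(\<integral>\<^sup>+y. ennreal \<bar>?w n y\<bar> \<partial>cara \<mu>) \<noteq> top"
        using fin ennreal_suminf_lessD[of "\<lambda>n. \<integral>\<^sup>+y. ennreal \<bar>?w n y\<bar> \<partial>cara \<mu>" top n]
        by (simp add: less_top)
      then show "(\<integral>\<^sup>+y. ennreal (norm (?w n y)) \<partial>cara \<mu>) < \<infinity>"
        by (simp add: less_top)
    qed measurable
    have "(\<integral>\<^sup>+y. ennreal \<bar>?w n y\<bar> \<partial>cara \<mu>) = ennreal (\<integral>y. \<bar>?w n y\<bar> \<partial>cara \<mu>)" for n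
      using int by (intro nn_integral_eq_integral) auto
    then have "summable (\<lambda>n. \<integral>y. \<bar>?w n y\<bar> \<partial>cara \<mu>)"
      using fin by (intro summable_suminf_not_top) auto
    with int show ?thesis
      by simp
  qed
  ultimately show ?thesis
    unfolding quasi_everywhere_def by blast
qed

lemma quasi_everywhere_mono:
  "quasi_everywhere \<mu> \<gamma> p P \<Longrightarrow> (\<And>x. P x \<Longrightarrow> Q x) \<Longrightarrow> quasi_everywhere \<mu> \<gamma> p Q"
  unfolding quasi_everywhere_def by blast

section \<open>Potentials of weakly convergent sequences\<close>

text \<open>Outside one set of capacity zero the potentials of Mazur's convex combinations converge to
  that of \<open>f\<close>, and they are convex combinations of tails of the potentials of the \<open>F i\<close>.\<close>

lemma weak_limit_quasi_everywhere:
  fixes F :: "nat \<Rightarrow> 'a::metric_space \<Rightarrow> real"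
  assumes p: "1 \<le> p" and K: "\<And>x. riesz_kernel \<mu> \<gamma> x \<in> borel_measurable (cara \<mu>)"
    and F: "\<And>i. F i \<in> Lp p (cara \<mu>)" and f: "f \<in> Lp p (cara \<mu>)"
    and weak: "weakly_converges_Lp p (cara \<mu>) F f"
  shows "quasi_everywhere \<mu> \<gamma> p (\<lambda>x.
    (\<forall>i. riesz_defined \<mu> \<gamma> (F i) x) \<and> riesz_defined \<mu> \<gamma> f x \<and>
    liminf (\<lambda>i. riesz_potential \<mu> \<gamma> (F i) x) \<le> riesz_potential \<mu> \<gamma> f x \<and>
    riesz_potential \<mu> \<gamma> f x \<le> limsup (\<lambda>i. riesz_potential \<mu> \<gamma> (F i) x))"
proof -
  let ?N = "Lp_norm p (cara \<mu>)"
  have "\<exists>g. g \<in> convex hull (F ` {n..}) \<and> ?N (g - f) < (1 / 2) ^ n" for n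
    using mazur_Lp[OF p F f weak, of "(1 / 2) ^ n" n] by auto
  then obtain g where g: "\<And>n. g n \<in> convex hull (F ` {n..})"
    and gf: "\<And>n. ?N (g n - f) < (1 / 2) ^ n"
    by metis
  have gLp: "g n \<in> Lp p (cara \<mu>)" for n
  proof -
    have "convex hull (F ` {n..}) \<subseteq> Lp p (cara \<mu>)"
      using F by (intro hull_minimal subspace_imp_convex subspace_Lp p) auto
    with g show ?thesis by blast
  qed
  define c where "c i = (1 / 2) ^ (2 * i) / (1 + ?N (F i))" for i
  have c: "0 < c i" for i
    by (auto simp: c_def intro!: divide_pos_pos add_pos_nonneg)
  \<comment> \<open>The differences \<open>g n - f\<close> are interleaved with multiples of the \<open>F i\<close>, so that one exceptional
    set controls the convergence and the finiteness of every potential involved.\<close>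
  define u where "u n = (if even n then c (n div 2) *\<^sub>R F (n div 2) else g n - f)" for n
  have uLp: "u n \<in> Lp p (cara \<mu>)" for n
    using F f gLp p by (auto simp: u_def intro!: Lp_scaleR Lp_diff)
  have u_le: "?N (u n) \<le> (1 / 2) ^ n" for n
  proof (cases "even n")
    case True
    then obtain i where n: "n = 2 * i" by blast
    have "?N (u n) = c i * ?N (F i)"
      using c[of i] p Lp_scaleR(2)[where c = "c i", OF _ F[of i]] by (simp add: u_def n)
    also have "\<dots> = (1 / 2) ^ n * (?N (F i) / (1 + ?N (F i)))"
      by (simp add: c_def n)
    also have "\<dots> \<le> (1 / 2) ^ n"
      by (intro mult_left_le) (auto simp: divide_le_eq add_pos_nonneg)
    finally show ?thesis .
  next
    case False
    with gf[of n] show ?thesis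
      by (simp add: u_def)
  qed
  have "summable (\<lambda>n. ?N (u n))"
    using u_le by (intro summable_comparison_test'[OF summable_geometric[of "1 / 2 :: real"]]) auto
  from riesz_series_quasi_everywhere[OF p uLp this K] show ?thesis
  proof (rule quasi_everywhere_mono, elim conjE)
    fix x
    let ?K = "riesz_kernel \<mu> \<gamma> x"
    let ?L = "\<lambda>v. \<integral>y. v y * ?K y \<partial>cara \<mu>"
    assume int: "\<forall>n. integrable (cara \<mu>) (\<lambda>y. u n y * ?K y)"
      and sum: "summable (\<lambda>n. \<integral>y. \<bar>u n y * ?K y\<bar> \<partial>cara \<mu>)"
    have intF: "integrable (cara \<mu>) (\<lambda>y. F i y * ?K y)" for i
    proof -
      have "integrable (cara \<mu>) (\<lambda>y. (1 / c i) * (u (2 * i) y * ?K y))"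
        using int by (intro integrable_mult_right) auto
      then show ?thesis
        using c[of i] by (simp add: u_def)
    qed
    have intg: "integrable (cara \<mu>) (\<lambda>y. g n y * ?K y)"
      and Lg: "?L (g n) \<in> convex hull ((\<lambda>v. ?L v) ` (F ` {n..}))" for n
      using integral_convex_hull[where M = "cara \<mu>" and k = ?K, OF _ g[of n]] intF by blast+
    have uodd: "u (2 * m + 1) y * ?K y = g (2 * m + 1) y * ?K y - f y * ?K y" for m y
      by (simp add: u_def algebra_simps)
    have intf: "integrable (cara \<mu>) (\<lambda>y. f y * ?K y)"
    proof -
      have "integrable (cara \<mu>) (\<lambda>y. g (2 * 0 + 1) y * ?K y - u (2 * 0 + 1) y * ?K y)"
        using intg int by (intro Bochner_Integration.integrable_diff) auto
      then show ?thesis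
        unfolding uodd by simp
    qed
    define b where "b m = ?L (g (2 * m + 1))" for m
    have "(\<lambda>n. \<integral>y. \<bar>u n y * ?K y\<bar> \<partial>cara \<mu>) \<longlonglongrightarrow> 0"
      by (rule summable_LIMSEQ_zero[OF sum])
    then have lim0: "(\<lambda>m. \<integral>y. \<bar>u (2 * m + 1) y * ?K y\<bar> \<partial>cara \<mu>) \<longlonglongrightarrow> 0"
      by (rule LIMSEQ_subseq_LIMSEQ[unfolded comp_def, where f = "\<lambda>m. 2 * m + 1"])
        (auto simp: strict_mono_def)
    have bound: "norm (b m - ?L f) \<le> (\<integral>y. \<bar>u (2 * m + 1) y * ?K y\<bar> \<partial>cara \<mu>)" for m
    proof -
      have "b m - ?L f = (\<integral>y. u (2 * m + 1) y * ?K y \<partial>cara \<mu>)"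
        unfolding uodd b_def using intg intf by simp
      then show ?thesis
        by simp
    qed
    have "(\<lambda>m. b m - ?L f) \<longlonglongrightarrow> 0"
      by (rule Lim_null_comparison[OF always_eventually[OF allI[OF bound]] lim0])
    then have b_lim: "b \<longlonglongrightarrow> ?L f"
      by (simp add: LIM_zero_iff)
    have b_hull: "b m \<in> convex hull ((\<lambda>i. ?L (F i)) ` {m..})" for m
    proof -
      have sub: "(\<lambda>v. ?L v) ` (F ` {2 * m + 1..}) \<subseteq> (\<lambda>i. ?L (F i)) ` {m..}"
        by auto
      show ?thesis
        unfolding b_def by (rule subsetD[OF hull_mono[OF sub] Lg])
    qed
    show "(\<forall>i. riesz_defined \<mu> \<gamma> (F i) x) \<and> riesz_defined \<mu> \<gamma> f x \<and>
      liminf (\<lambda>i. riesz_potential \<mu> \<gamma> (F i) x) \<le> riesz_potential \<mu> \<gamma> f x \<and>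
      riesz_potential \<mu> \<gamma> f x \<le> limsup (\<lambda>i. riesz_potential \<mu> \<gamma> (F i) x)"
      using convex_hull_tail_limit[OF b_hull b_lim] riesz_potential_eq_integral[OF intF]
        riesz_potential_eq_integral[OF intf] by simp
  qed
qed

text \<open>Truncating the kernel in height and in space makes integration against it a bounded functional
  on \<open>L\<^sup>p\<close>, on which weak convergence can be tested at every point \<open>x\<close>. For non-negative
  functions the truncation only lowers the potential, and Fatou's lemma removes it in the limit.\<close>

lemma riesz_pos_le_liminf:
  fixes F :: "nat \<Rightarrow> 'a::metric_space \<Rightarrow> real"
  assumes p: "1 \<le> p" and \<mu>: "borel_regular_outer_measure \<mu>"
    and fin: "\<And>x r. 0 < r \<Longrightarrow> \<mu> (ball x r) < \<infinity>"
    and F: "\<And>i. F i \<in> Lp_plus p (cara \<mu>)" and f: "f \<in> Lp_plus p (cara \<mu>)"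
    and weak: "weakly_converges_Lp p (cara \<mu>) F f"
  shows "riesz_pos \<mu> \<gamma> f x \<le> liminf (\<lambda>i. riesz_pos \<mu> \<gamma> (F i) x)"
proof -
  let ?K = "riesz_kernel \<mu> \<gamma> x"
  \<comment> \<open>The radius \<open>n + 1\<close> is positive also for \<open>n = 0\<close>, so each of these balls has finite measure.\<close>
  define k where "k n y = indicator (ball x (real n + 1)) y * min (real n) (?K y)" for n y
  have [measurable]: "?K \<in> borel_measurable (cara \<mu>)"
    by (rule riesz_kernel_measurable[OF \<mu> fin])
  have ball [measurable]: "ball x r \<in> sets (cara \<mu>)" for r
    by (intro borel_sets_cara(1)[OF \<mu>]) auto
  have ball_fin: "emeasure (cara \<mu>) (ball x (real n + 1)) < \<infinity>" for n
    using fin[of "real n + 1" x] by (subst borel_sets_cara(2)[OF \<mu>]) auto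
  have k_meas [measurable]: "k n \<in> borel_measurable (cara \<mu>)" for n
    unfolding k_def[abs_def] by measurable
  have k_bound: "\<bar>k n y\<bar> \<le> real n * indicator (ball x (real n + 1)) y" for n y
    by (auto simp: k_def indicator_def)
  have k_nonneg: "0 \<le> k n y" and k_le: "k n y \<le> ?K y" for n y
    by (auto simp: k_def indicator_def)
  note int = integral_bounded_Lp[OF p _ ball ball_fin k_meas k_bound of_nat_0_le_iff]
  have dual: "(\<lambda>v. \<integral>y. v y * k n y \<partial>cara \<mu>) \<in> Lp_dual p (cara \<mu>)" for n
    unfolding Lp_dual_def mem_Collect_eq
  proof (intro conjI ballI allI exI)
    fix v assume v: "v \<in> Lp p (cara \<mu>)"
    show "\<bar>\<integral>y. v y * k n y \<partial>cara \<mu>\<bar>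
        \<le> (real n * (measure (cara \<mu>) (ball x (real n + 1)) + 1)) * Lp_norm p (cara \<mu>) v"
      by (rule int(2)[OF v])
  qed (use int(1) in \<open>auto simp: distrib_right mult.assoc\<close>)
  have pos: "(\<integral>\<^sup>+y. ennreal (v y * k n y) \<partial>cara \<mu>) = ennreal (\<integral>y. v y * k n y \<partial>cara \<mu>)"
    if v: "v \<in> Lp_plus p (cara \<mu>)" for v n
  proof (rule nn_integral_eq_integral)
    have "v \<in> Lp p (cara \<mu>)" "AE y in cara \<mu>. 0 \<le> v y"
      using v by (auto simp: Lp_plus_def)
    then show "integrable (cara \<mu>) (\<lambda>y. v y * k n y)" "AE y in cara \<mu>. 0 \<le> v y * k n y"
      using int(1) k_nonneg by (auto elim: eventually_mono)
  qed
  have le: "(\<integral>\<^sup>+y. ennreal (f y * k n y) \<partial>cara \<mu>) \<le> liminf (\<lambda>i. riesz_pos \<mu> \<gamma> (F i) x)" for n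
  proof -
    have "(\<lambda>i. \<integral>y. F i y * k n y \<partial>cara \<mu>) \<longlonglongrightarrow> (\<integral>y. f y * k n y \<partial>cara \<mu>)"
      using bspec[OF weak[unfolded weakly_converges_Lp_def] dual[of n]] .
    then have "(\<lambda>i. \<integral>\<^sup>+y. ennreal (F i y * k n y) \<partial>cara \<mu>) \<longlonglongrightarrow> (\<integral>\<^sup>+y. ennreal (f y * k n y) \<partial>cara \<mu>)"
      unfolding pos[OF F] pos[OF f] by (rule tendsto_ennrealI)
    then have "(\<integral>\<^sup>+y. ennreal (f y * k n y) \<partial>cara \<mu>)
        = liminf (\<lambda>i. \<integral>\<^sup>+y. ennreal (F i y * k n y) \<partial>cara \<mu>)"
      by (intro lim_imp_Liminf[symmetric]) auto
    also have "\<dots> \<le> liminf (\<lambda>i. riesz_pos \<mu> \<gamma> (F i) x)"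
    proof (intro Liminf_mono always_eventually allI)
      fix i
      have "AE y in cara \<mu>. 0 \<le> F i y"
        using F by (simp add: Lp_plus_def)
      then show "(\<integral>\<^sup>+y. ennreal (F i y * k n y) \<partial>cara \<mu>) \<le> riesz_pos \<mu> \<gamma> (F i) x"
        unfolding riesz_pos_eq
        by (intro nn_integral_mono_AE) (auto elim!: eventually_mono intro!: ennreal_leI mult_left_mono k_le)
    qed
    finally show ?thesis .
  qed
  have k_lim: "(\<lambda>n. ennreal (f y * k n y)) \<longlonglongrightarrow> ennreal (f y * ?K y)" for y
  proof (rule tendsto_eventually)
    obtain n0 :: nat where n0: "max (dist x y) (?K y) < real n0"
      using reals_Archimedean2 by blast
    show "\<forall>\<^sub>F n in sequentially. ennreal (f y * k n y) = ennreal (f y * ?K y)"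
      using eventually_ge_at_top[of n0]
    proof eventually_elim
      fix n assume "n0 \<le> n"
      then have "real n0 \<le> real n"
        by simp
      with n0 have "dist x y < real n + 1" "?K y \<le> real n"
        by auto
      then show "ennreal (f y * k n y) = ennreal (f y * ?K y)"
        by (simp add: k_def)
    qed
  qed
  have [measurable]: "f \<in> borel_measurable (cara \<mu>)"
    using f by (auto simp: Lp_plus_def Lp_def)
  have "riesz_pos \<mu> \<gamma> f x = (\<integral>\<^sup>+y. liminf (\<lambda>n. ennreal (f y * k n y)) \<partial>cara \<mu>)"
    unfolding riesz_pos_eq by (intro nn_integral_cong lim_imp_Liminf[symmetric] k_lim) auto
  also have "\<dots> \<le> liminf (\<lambda>n. \<integral>\<^sup>+y. ennreal (f y * k n y) \<partial>cara \<mu>)"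
    by (intro nn_integral_liminf) measurable
  also have "\<dots> \<le> liminf (\<lambda>i. riesz_pos \<mu> \<gamma> (F i) x)"
    using le by (intro Liminf_le) auto
  finally show ?thesis .
qed

theorem theorem3p10:
  fixes \<mu> :: "'a::metric_space set \<Rightarrow> ennreal"
    and p \<gamma> :: real
    and F :: "nat \<Rightarrow> 'a \<Rightarrow> real"
    and f :: "'a \<Rightarrow> real"
  assumes "locally_compact_space (euclidean :: 'a topology)"
    and "borel_regular_outer_measure \<mu>"
    and "doubling \<mu>"
    and "\<And>x r. r > 0 \<Longrightarrow> 0 < \<mu> (ball x r) \<and> \<mu> (ball x r) < \<infinity>"
    and "\<And>x r. r > 0 \<Longrightarrow> \<mu> {y. dist x y = r} = 0"
    and "\<And>x. \<mu> {x} = 0"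
    and "1 < p" and "0 < \<gamma>" and "\<gamma> < 1"
    and "\<And>i. F i \<in> Lp p (cara \<mu>)" and "f \<in> Lp p (cara \<mu>)"
  shows "(weakly_converges_Lp p (cara \<mu>) F f \<longrightarrow>
            quasi_everywhere \<mu> \<gamma> p (\<lambda>x.
              (\<forall>i. riesz_defined \<mu> \<gamma> (F i) x) \<and> riesz_defined \<mu> \<gamma> f x \<and>
              liminf (\<lambda>i. riesz_potential \<mu> \<gamma> (F i) x) \<le> riesz_potential \<mu> \<gamma> f x \<and>
              riesz_potential \<mu> \<gamma> f x \<le> limsup (\<lambda>i. riesz_potential \<mu> \<gamma> (F i) x)))
       \<and> ((\<forall>i. F i \<in> Lp_plus p (cara \<mu>)) \<and> f \<in> Lp_plus p (cara \<mu>) \<and>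
          weakly_converges_Lp p (cara \<mu>) F f \<longrightarrow>
            (\<forall>x. riesz_potential \<mu> \<gamma> f x \<le> liminf (\<lambda>i. riesz_potential \<mu> \<gamma> (F i) x)) \<and>
            quasi_everywhere \<mu> \<gamma> p (\<lambda>x.
              riesz_potential \<mu> \<gamma> f x = liminf (\<lambda>i. riesz_potential \<mu> \<gamma> (F i) x)))"
proof -
  have p: "1 \<le> p" and fin: "\<And>x r. 0 < r \<Longrightarrow> \<mu> (ball x r) < \<infinity>"
    using assms by auto
  have K: "riesz_kernel \<mu> \<gamma> x \<in> borel_measurable (cara \<mu>)" for x
    by (rule riesz_kernel_measurable[OF assms(2) fin])
  note part1 = weak_limit_quasi_everywhere[OF p K assms(10,11)]
  have part2: "riesz_potential \<mu> \<gamma> f x \<le> liminf (\<lambda>i. riesz_potential \<mu> \<gamma> (F i) x)"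
    if F: "\<And>i. F i \<in> Lp_plus p (cara \<mu>)" and f: "f \<in> Lp_plus p (cara \<mu>)"
      and weak: "weakly_converges_Lp p (cara \<mu>) F f" for x
  proof -
    have "enn2ereal (riesz_pos \<mu> \<gamma> f x) \<le> enn2ereal (liminf (\<lambda>i. riesz_pos \<mu> \<gamma> (F i) x))"
      using riesz_pos_le_liminf[OF p assms(2) fin F f weak] by (simp add: less_eq_ennreal.rep_eq)
    also have "\<dots> = liminf (\<lambda>i. enn2ereal (riesz_pos \<mu> \<gamma> (F i) x))"
      by (intro Liminf_compose_continuous_mono[symmetric] continuous_on_enn2ereal)
        (auto simp: mono_def less_eq_ennreal.rep_eq)
    finally show ?thesis
      by (simp add: riesz_potential_Lp_plus[OF F] riesz_potential_Lp_plus[OF f])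
  qed
  show ?thesis
    using part1 part2 by (auto intro!: quasi_everywhere_mono[OF part1] antisym)
qed

end
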